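(* Let $f(x)=ax^2+c$ where $c\in\mathbb{H}_s$ and $a=1+a_2\mathbf{j}+a_3\mathbf{k}\in\mathbb{H}_s$ with $a_2,a_3\in\mathbb{R}$ and $I_a=0$. If $f(x)=0$ has a solution $x\in\mathbb{H}_s$, then the companion polynomial $C(x)$ of $f$ is the zero polynomial.
   Context: $\mathbb{H}_s$ is the real algebra of split quaternions $x=x_0+x_1\mathbf{i}+x_2\mathbf{j}+x_3\mathbf{k}$ ($x_i\in\mathbb{R}$), with $\mathbf{i}^2=-1$, $\mathbf{j}^2=\mathbf{k}^2=1$, $\mathbf{i}\mathbf{j}=\mathbf{k}=-\mathbf{j}\mathbf{i}$, $\mathbf{j}\mathbf{k}=-\mathbf{i}=-\mathbf{k}\mathbf{j}$, $\mathbf{k}\mathbf{i}=\mathbf{j}=-\mathbf{i}\mathbf{k}$. The conjugate is $\bar x=x_0-x_1\mathbf{i}-x_2\mathbf{j}-x_3\mathbf{k}$, and $I_x=\bar x x=x_0^2+x_1^2-x_2^2-x_3^2$. The companion polynomial of $f(x)=\sum_{j=0}^n a_jx^j$ ($a_j\in\mathbb{H}_s$) is $C(x)=\sum_{j,k=0}^{n}\overline{a_j}\,a_k\,x^{j+k}$, where $x$ is regarded as an indeterminate commuting with the coefficients; it has real coefficients. *)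

theory Defs
  imports Complex_Main "HOL-Computational_Algebra.Polynomial"
begin

datatype split_quat = SQuat (sq0: real) (sq1: real) (sq2: real) (sq3: real)

lemma split_quat_eq_iff:
  "x = y \<longleftrightarrow> sq0 x = sq0 y \<and> sq1 x = sq1 y \<and> sq2 x = sq2 y \<and> sq3 x = sq3 y"
  by (cases x; cases y) simp

instantiation split_quat :: real_algebra_1
begin

definition "0 = SQuat 0 0 0 0"
definition "1 = SQuat 1 0 0 0"
definition "x + y = SQuat (sq0 x + sq0 y) (sq1 x + sq1 y) (sq2 x + sq2 y) (sq3 x + sq3 y)"
definition "- x = SQuat (- sq0 x) (- sq1 x) (- sq2 x) (- sq3 x)"
definition "x - y = SQuat (sq0 x - sq0 y) (sq1 x - sq1 y) (sq2 x - sq2 y) (sq3 x - sq3 y)"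
definition "r *\<^sub>R x = SQuat (r * sq0 x) (r * sq1 x) (r * sq2 x) (r * sq3 x)"
definition "x * y = SQuat
  (sq0 x * sq0 y - sq1 x * sq1 y + sq2 x * sq2 y + sq3 x * sq3 y)
  (sq0 x * sq1 y + sq1 x * sq0 y - sq2 x * sq3 y + sq3 x * sq2 y)
  (sq0 x * sq2 y - sq1 x * sq3 y + sq2 x * sq0 y + sq3 x * sq1 y)
  (sq0 x * sq3 y + sq1 x * sq2 y - sq2 x * sq1 y + sq3 x * sq0 y)"

instance
  by standard
    (simp_all add: zero_split_quat_def one_split_quat_def plus_split_quat_def
      uminus_split_quat_def minus_split_quat_def scaleR_split_quat_def
      times_split_quat_def algebra_simps)

end

lemmas split_quat_defs = zero_split_quat_def one_split_quat_def plus_split_quat_def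
  uminus_split_quat_def minus_split_quat_def scaleR_split_quat_def times_split_quat_def

definition sq_i :: split_quat where "sq_i = SQuat 0 1 0 0"
definition sq_j :: split_quat where "sq_j = SQuat 0 0 1 0"
definition sq_k :: split_quat where "sq_k = SQuat 0 0 0 1"

lemma SQuat_eq: "SQuat x0 x1 x2 x3 = of_real x0 + x1 *\<^sub>R sq_i + x2 *\<^sub>R sq_j + x3 *\<^sub>R sq_k"
  by (simp add: split_quat_defs of_real_def sq_i_def sq_j_def sq_k_def)

lemma split_quat_mult_table:
  "sq_i * sq_i = -1" "sq_j * sq_j = 1" "sq_k * sq_k = 1"
  "sq_i * sq_j = sq_k" "sq_j * sq_i = - sq_k"
  "sq_j * sq_k = - sq_i" "sq_k * sq_j = sq_i"
  "sq_k * sq_i = sq_j" "sq_i * sq_k = - sq_j"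
  by (simp_all add: split_quat_defs sq_i_def sq_j_def sq_k_def)

definition sq_cnj :: "split_quat \<Rightarrow> split_quat" where
  "sq_cnj x = SQuat (sq0 x) (- sq1 x) (- sq2 x) (- sq3 x)"

definition sq_I :: "split_quat \<Rightarrow> real" where
  "sq_I x = (sq0 x)\<^sup>2 + (sq1 x)\<^sup>2 - (sq2 x)\<^sup>2 - (sq3 x)\<^sup>2"

lemma sq_cnj_mult_self: "sq_cnj x * x = of_real (sq_I x)"
  by (simp add: split_quat_defs of_real_def sq_cnj_def sq_I_def power2_eq_square)

text \<open>
  The coefficients do not commute, so the library's \<^const>\<open>poly\<close> (which needs a commutative
  semiring) is not available; values are taken with the coefficients on the left.
\<close>

definition sq_eval :: "split_quat poly \<Rightarrow> split_quat \<Rightarrow> split_quat" where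
  "sq_eval f x = (\<Sum>j\<le>degree f. coeff f j * x ^ j)"

text \<open>
  The product of polynomials is likewise only defined over commutative coefficients, hence
  the explicit double sum. The coefficients are real by \<open>coeff_companion_poly_real\<close> below.
\<close>

definition companion_poly :: "split_quat poly \<Rightarrow> split_quat poly" where
  "companion_poly f =
    (\<Sum>j\<le>degree f. \<Sum>k\<le>degree f. monom (sq_cnj (coeff f j) * coeff f k) (j + k))"

lemma sq_cnj_eq_imp_real:
  assumes "sq_cnj x = x"
  shows "x \<in> \<real>"
proof -
  have "x = of_real (sq0 x)"
    using assms by (simp add: split_quat_eq_iff sq_cnj_def of_real_def split_quat_defs)
  then show ?thesis by (metis Reals_of_real)
qed

lemma sq_cnj_0: "sq_cnj 0 = 0"
  by (simp add: sq_cnj_def zero_split_quat_def)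

lemma sq_cnj_add: "sq_cnj (x + y) = sq_cnj x + sq_cnj y"
  by (simp add: sq_cnj_def plus_split_quat_def)

lemma sq_cnj_mult: "sq_cnj (x * y) = sq_cnj y * sq_cnj x"
  by (simp add: sq_cnj_def split_quat_defs algebra_simps)

lemma sq_cnj_cnj: "sq_cnj (sq_cnj x) = x"
  by (simp add: sq_cnj_def)

lemma sq_cnj_sum: "sq_cnj (sum g A) = (\<Sum>x\<in>A. sq_cnj (g x))"
  by (induction A rule: infinite_finite_induct)
    (simp_all add: sq_cnj_0 sq_cnj_add)

lemma coeff_companion_poly_real: "coeff (companion_poly f) m \<in> \<real>"
proof (rule sq_cnj_eq_imp_real)
  let ?g = "\<lambda>j k. if j + k = m then sq_cnj (coeff f j) * coeff f k else 0"
  have coeff: "coeff (companion_poly f) m = (\<Sum>j\<le>degree f. \<Sum>k\<le>degree f. ?g j k)"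
    by (simp add: companion_poly_def coeff_sum)
  have "sq_cnj (?g j k) = ?g k j" for j k
    by (simp add: sq_cnj_mult sq_cnj_cnj sq_cnj_0 add.commute)
  then have "sq_cnj (coeff (companion_poly f) m) = (\<Sum>j\<le>degree f. \<Sum>k\<le>degree f. ?g k j)"
    unfolding coeff sq_cnj_sum by simp
  also have "\<dots> = coeff (companion_poly f) m"
    unfolding coeff by (rule sum.swap)
  finally show "sq_cnj (coeff (companion_poly f) m) = coeff (companion_poly f) m" .
qed

end

theory Submission
  imports Defs
begin

text \<open>
  A zero \<open>x\<close> of \<open>f\<close> gives \<open>c = - a x\<^sup>2\<close>, so all coefficients of \<open>f\<close>
  lie in the right ideal generated by \<open>a\<close>. Each coefficient of the companion polynomial is a sum
  of products of the conjugate of one such element with another, and in every such product the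
  factor \<open>sq_cnj a * a\<close> appears in the middle. This factor is \<open>I\<^sub>a = 0\<close>, so every product
  vanishes (lemma \<open>companion_poly_eq_0_if_coeffs_in_null_right_ideal\<close>).
\<close>

lemma sq_cnj_mult_eq_0_in_null_right_ideal:
  assumes "sq_I a = 0"
  shows "sq_cnj (a * u) * (a * v) = 0"
proof -
  have "sq_cnj (a * u) * (a * v) = sq_cnj u * (sq_cnj a * a) * v"
    by (simp add: sq_cnj_mult mult.assoc)
  then show ?thesis
    using assms by (simp add: sq_cnj_mult_self)
qed

lemma companion_poly_eq_0_if_coeffs_in_null_right_ideal:
  assumes "sq_I a = 0" and "\<And>j. \<exists>u. coeff f j = a * u"
  shows "companion_poly f = 0"
proof -
  have "sq_cnj (coeff f j) * coeff f k = 0" for j k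
    using assms sq_cnj_mult_eq_0_in_null_right_ideal by metis
  then show ?thesis
    by (simp add: companion_poly_def)
qed

lemma sq_eval_monom_2_plus_const:
  assumes "a \<noteq> 0"
  shows "sq_eval (monom a 2 + monom c 0) x = a * x ^ 2 + c"
proof -
  have "degree (monom a 2 + monom c 0) = 2"
    using assms degree_add_eq_left[of "monom c 0" "monom a 2"]
    by (simp add: degree_monom_eq monom_0)
  then show ?thesis
    by (simp add: sq_eval_def numeral_2_eq_2)
qed

theorem proposition2p1:
  fixes a c :: split_quat and a2 a3 :: real and f :: "split_quat poly"
  assumes "a = 1 + a2 *\<^sub>R sq_j + a3 *\<^sub>R sq_k"
    and "sq_I a = 0"
    and "f = monom a 2 + monom c 0"
    and "\<exists>x. sq_eval f x = 0"
  shows "companion_poly f = 0"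
proof -
  have "sq0 a = 1"
    by (simp add: assms(1) split_quat_defs sq_j_def sq_k_def)
  then have "a \<noteq> 0"
    by (auto simp: zero_split_quat_def)
  then obtain x where "a * x ^ 2 + c = 0"
    using assms(3,4) sq_eval_monom_2_plus_const by metis
  then have c: "c = a * - (x ^ 2)"
    by (simp add: eq_neg_iff_add_eq_0 add.commute)
  have "\<exists>u. coeff f j = a * u" for j
  proof -
    have "coeff f j = a * ((if j = 2 then 1 else 0) + (if j = 0 then - (x ^ 2) else 0))"
      by (simp add: assms(3) c)
    then show ?thesis ..
  qed
  with assms(2) show ?thesis
    by (rule companion_poly_eq_0_if_coeffs_in_null_right_ideal)
qed

end
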